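(* Let $n\ge1$ and let $X_1,\dots,X_n$ be independent integer-valued random variables such that $\|f_{X_i}\|_\infty=c_i\geq\frac12$ for every $i$. Then $$\Delta_\infty(X_1+\cdots+X_n)\ \geq\ \frac{\pi^2}{36}\sum_{j=1}^n\Delta_\infty(X_j).$$
   Context: For an integer-valued random variable $X$, $f_X(k)=\mathbb{P}(X=k)$ for $k\in\mathbb{Z}$, $\|f_X\|_\infty=\sup_{k\in\mathbb{Z}}f_X(k)$, and $\Delta_\infty(X)=\|f_X\|_\infty^{-2}-1$. *)

theory Defs
  imports "HOL-Probability.Probability"
begin

definition prob_fun :: "'a measure \<Rightarrow> ('a \<Rightarrow> int) \<Rightarrow> int \<Rightarrow> real" where
  "prob_fun M X k = \<P>(\<omega> in M. X \<omega> = k)"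

(* On a probability space the values of prob_fun lie in [0,1],
   so the supremum over the reals is the genuine one. *)
definition sup_prob :: "'a measure \<Rightarrow> ('a \<Rightarrow> int) \<Rightarrow> real" where
  "sup_prob M X = (SUP k. prob_fun M X k)"

definition Delta_inf :: "'a measure \<Rightarrow> ('a \<Rightarrow> int) \<Rightarrow> real" where
  "Delta_inf M X = 1 / (sup_prob M X)\<^sup>2 - 1"

end

theory Submission
  imports Defs
begin

text \<open>By Fourier inversion, \<open>P(S = k)\<close> is at most the mean over \<open>t \<in> [-\<pi>, \<pi>]\<close> of
  \<open>\<Prod>\<^sub>i |\<phi>\<^sub>i(t)|\<close>, where \<open>\<phi>\<^sub>i\<close> is the characteristic function of \<open>X\<^sub>i\<close>.
  Put \<open>d\<^sub>i = 1 / c\<^sub>i\<^sup>2 - 1\<close> and \<open>D = \<Sum>\<^sub>i d\<^sub>i\<close>. Weighted AM-GM (that is, Hoelder) with the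
  exponents \<open>p\<^sub>i = D / d\<^sub>i\<close> reduces the claim to: the mean of \<open>|\<phi>\<^sub>i|\<close> to the power \<open>p\<close> is at most
  \<open>1 / sqrt (1 + p d\<^sub>i / 3)\<close> for all \<open>p \<ge> 1\<close>; note \<open>\<pi>\<^sup>2 / 36 < 1 / 3\<close>.
  The law of \<open>X\<^sub>i\<close> is a mixture of two-point laws with mass \<open>c\<^sub>i\<close> at the mode and \<open>1 - c\<^sub>i\<close> at another
  integer, so by convexity only such two-point laws matter. If the points differ by \<open>m \<noteq> 0\<close>, then
  \<open>|\<phi>|\<^sup>2 = 1 - a s\<close> with \<open>a = 4 c (1 - c)\<close> and \<open>s = sin\<^sup>2 (m t / 2)\<close>.
  For \<open>p \<le> 2\<close> concavity bounds the mean by \<open>1 - a / 2\<close> to the power \<open>p / 2\<close>. For \<open>p \<ge> 2\<close> one uses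
  \<open>(1 - a s)\<close> to the power \<open>p / 2\<close> \<open>\<le> (1 - a s) / (1 + b s)\<^sup>2\<close> with \<open>b = (p / 2 - 1) a / 2\<close>.\<close>

subsection \<open>Power inequalities\<close>

lemma bernoulli_powr_le:
  fixes x r :: real
  assumes "0 \<le> x" "0 \<le> r" "r \<le> 1"
  shows "x powr r \<le> 1 + r * (x - 1)"
proof (cases "x = 0")
  case True
  then show ?thesis using assms by simp
next
  case False
  then show ?thesis
    using Youngs_inequality_0[of r "1 - r" x 1] assms by (simp add: algebra_simps)
qed

text \<open>Follows from the concave case with exponent \<open>1 / r\<close>, applied to
  \<open>x powr r\<close>.\<close>

lemma bernoulli_powr_ge:
  fixes x r :: real
  assumes "0 \<le> x" "1 \<le> r"
  shows "1 + r * (x - 1) \<le> x powr r"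
proof -
  have "(x powr r) powr (1 / r) \<le> 1 + 1 / r * (x powr r - 1)"
    using assms by (intro bernoulli_powr_le) auto
  then have "x \<le> 1 + 1 / r * (x powr r - 1)"
    using assms by (simp add: powr_powr)
  then have "r * x \<le> r * (1 + 1 / r * (x powr r - 1))"
    using assms by (intro mult_left_mono) auto
  also have "\<dots> = r + x powr r - 1"
    using assms(2) by (simp add: distrib_left)
  finally show ?thesis
    by (simp add: algebra_simps)
qed

lemma weighted_arith_geom_mean:
  fixes w y :: "'i \<Rightarrow> real"
  assumes "finite I" "\<And>i. i \<in> I \<Longrightarrow> 0 \<le> w i" "(\<Sum>i\<in>I. w i) = 1" "\<And>i. i \<in> I \<Longrightarrow> 0 \<le> y i"
  shows "(\<Prod>i\<in>I. y i powr w i) \<le> (\<Sum>i\<in>I. w i * y i)"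
proof (cases "\<exists>i\<in>I. y i = 0")
  case True
  \<comment> \<open>A zero \<open>y i\<close> of weight 0 also gives a zero factor, since
    \<open>0 powr 0 = 0\<close>.\<close>
  then have "(\<Prod>i\<in>I. y i powr w i) = 0"
    using assms(1) by auto
  moreover have "0 \<le> (\<Sum>i\<in>I. w i * y i)"
    using assms by (intro sum_nonneg) auto
  ultimately show ?thesis by simp
next
  case False
  then have pos: "0 < y i" if "i \<in> I" for i
    using assms(4)[OF that] that by force
  have "exp (\<Sum>i\<in>I. w i *\<^sub>R ln (y i)) \<le> (\<Sum>i\<in>I. w i * exp (ln (y i)))"
    using assms by (intro convex_on_sum[OF _ _ exp_convex]) auto
  moreover have "exp (\<Sum>i\<in>I. w i *\<^sub>R ln (y i)) = (\<Prod>i\<in>I. y i powr w i)"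
    using assms(1) by (auto simp: exp_sum powr_def intro!: prod.cong dest: pos)
  ultimately show ?thesis using pos by simp
qed

subsection \<open>Means over the circle\<close>

text \<open>The uniform law on \<open>{-pi..pi}\<close>, kept as a density on the whole line so that
  measurability stays ordinary Borel measurability.\<close>

definition circle :: "real measure" where
  "circle = density lborel (\<lambda>t. ennreal (indicator {-pi..pi} t / (2 * pi)))"

lemma sets_circle [simp, measurable_cong]: "sets circle = sets borel"
  by (simp add: circle_def)

lemma space_circle [simp]: "space circle = UNIV"
  by (simp add: circle_def)

lemma prob_space_circle: "prob_space circle"
proof
  have "emeasure circle (space circle)
      = (\<integral>\<^sup>+ t. ennreal (1 / (2 * pi)) * indicator {-pi..pi} t \<partial>lborel)"
    by (auto simp: circle_def emeasure_density intro!: nn_integral_cong split: split_indicator)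
  also have "\<dots> = 1"
    by (subst nn_integral_cmult_indicator) (auto simp flip: ennreal_mult)
  finally show "emeasure circle (space circle) = 1" .
qed

lemma integral_circle_FTC:
  fixes F f :: "real \<Rightarrow> real"
  assumes "\<And>t. (F has_real_derivative f t) (at t)" "continuous_on UNIV f"
  shows "(\<integral>t. f t \<partial>circle) = (F pi - F (-pi)) / (2 * pi)"
proof -
  have "(\<integral>t. f t \<partial>circle) = (\<integral>t. (indicator {-pi..pi} t / (2 * pi)) *\<^sub>R f t \<partial>lborel)"
    unfolding circle_def using assms(2)
    by (intro integral_density) (auto intro: borel_measurable_continuous_onI)
  also have "\<dots> = (\<integral>t. f t * indicator {-pi..pi} t / (2 * pi) \<partial>lborel)"
    by (simp add: mult.commute)
  also have "\<dots> = (\<integral>t. f t * indicator {-pi..pi} t \<partial>lborel) / (2 * pi)"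
    by simp
  also have "(\<integral>t. f t * indicator {-pi..pi} t \<partial>lborel) = F pi - F (-pi)"
    using assms by (intro integral_FTC_Icc_real) (auto simp: continuous_on_eq_continuous_at)
  finally show ?thesis .
qed

lemma integrable_circle_bounded:
  fixes f :: "real \<Rightarrow> real"
  assumes "f \<in> borel_measurable borel" "\<And>t. \<bar>f t\<bar> \<le> B"
  shows "integrable circle f"
proof -
  interpret prob_space circle by (rule prob_space_circle)
  have "f \<in> borel_measurable circle"
    using assms(1) measurable_cong_sets[OF sets_circle refl, of borel] by auto
  then show ?thesis
    using assms by (intro integrable_const_bound[where B = B]) auto
qed

text \<open>Orthogonality of characters: taken at \<open>m = X \<omega> - k\<close>, the mean
  becomes the indicator of \<open>X = k\<close>, which is the source of Fourier inversion
  below.\<close>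

lemma integral_circle_cos:
  fixes m :: int
  shows "(\<integral>t. cos (t * m) \<partial>circle) = (if m = 0 then 1 else 0)"
proof (cases "m = 0")
  case True
  interpret prob_space circle by (rule prob_space_circle)
  show ?thesis using True prob_space by simp
next
  case False
  have "(\<integral>t. cos (t * m) \<partial>circle) = (sin (pi * m) / m - sin (- pi * m) / m) / (2 * pi)"
    using False
    by (intro integral_circle_FTC) (auto intro!: derivative_eq_intros continuous_intros)
  also have "\<dots> = 0"
    by (simp add: sin_integer_2pi sin_zero_iff_int2)
  finally show ?thesis using False by simp
qed

text \<open>The product is half of \<open>sin (pi * m)\<close>. It kills the periodic part of the
  antiderivatives at both ends of the circle.\<close>

lemma cos_sin_pi_half_int:
  fixes m :: int
  shows "sin (pi * m / 2) * cos (pi * m / 2) = 0"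
  using sin_double[of "pi * m / 2"] by (simp add: sin_zero_iff_int2)

lemma integral_circle_sin_squared:
  fixes m :: int
  assumes "m \<noteq> 0"
  shows "(\<integral>t. A + B * (sin (m * t / 2))\<^sup>2 \<partial>circle) = A + B / 2"
proof -
  let ?F = "\<lambda>t::real. A * t + B * (t / 2 - sin (m * t / 2) * cos (m * t / 2) / m)"
  have "(?F has_real_derivative A + B * (sin (m * t / 2))\<^sup>2) (at t)" for t :: real
  proof -
    have "(?F has_real_derivative A + B * (1 / 2 - (cos (m * t / 2) * (m / 2) * cos (m * t / 2)
        - sin (m * t / 2) * (sin (m * t / 2) * (m / 2))) / m)) (at t)"
      using assms by (auto intro!: derivative_eq_intros)
    also have "1 / 2 - (cos (m * t / 2) * (m / 2) * cos (m * t / 2)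
        - sin (m * t / 2) * (sin (m * t / 2) * (m / 2))) / m = (sin (m * t / 2))\<^sup>2"
    proof -
      have "(C * (m / 2) * C - S * (S * (m / 2))) / m = (C\<^sup>2 - S\<^sup>2) / 2" for C S :: real
        using assms by (simp add: field_simps power2_eq_square)
      then show ?thesis by (simp only: cos_squared_eq) (simp add: field_simps)
    qed
    finally show ?thesis .
  qed
  then have "(\<integral>t. A + B * (sin (m * t / 2))\<^sup>2 \<partial>circle) = (?F pi - ?F (- pi)) / (2 * pi)"
    by (intro integral_circle_FTC) (auto intro!: continuous_intros)
  also have "\<dots> = A + B / 2"
    using cos_sin_pi_half_int[of m] by (simp add: field_simps)
  finally show ?thesis .
qed

text \<open>With \<open>x = m t / 2\<close> and
  \<open>v = 1 + (k\<^sup>2 - 1) * (sin x)\<^sup>2\<close>, the integrand is a combination of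
  \<open>1 / v\<close>, whose primitive is \<open>H / k\<close>, and of the derivative of
  \<open>Q\<close>. \<open>Q\<close> vanishes at both endpoints, so only the growth of
  \<open>H\<close> contributes and the mean is \<open>\<alpha> / k\<close>.\<close>

lemma integral_circle_rational:
  fixes m :: int and k a :: real
  assumes "m \<noteq> 0" "1 \<le> k"
  shows "(\<integral>t. (1 - a * (sin (m * t / 2))\<^sup>2) / (1 + (k\<^sup>2 - 1) * (sin (m * t / 2))\<^sup>2)\<^sup>2 \<partial>circle)
    = (k\<^sup>2 + 1 - a) / (2 * k ^ 3)"
proof -
  \<comment> \<open>Chosen so that \<open>\<alpha> * v + (1 - \<alpha>) * ((cos x)\<^sup>2 -
    k\<^sup>2 * (sin x)\<^sup>2)\<close> equals the numerator
    \<open>1 - a * (sin x)\<^sup>2\<close>.\<close>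
  define \<alpha> where "\<alpha> = (k\<^sup>2 + 1 - a) / (2 * k\<^sup>2)"
  \<comment> \<open>By the subtraction formula, \<open>(k - 1) * P x\<close> is the tangent of the
    difference between \<open>arctan (k * tan x)\<close> and \<open>x\<close>; its denominator never
    vanishes.\<close>
  define P where "P = (\<lambda>x::real. sin x * cos x / ((cos x)\<^sup>2 + k * (sin x)\<^sup>2))"
  define Q where "Q = (\<lambda>x::real. sin x * cos x / ((cos x)\<^sup>2 + k\<^sup>2 * (sin x)\<^sup>2))"
  \<comment> \<open>a branch of \<open>arctan (k * tan x)\<close> that is smooth on the whole line\<close>
  define H where "H = (\<lambda>x. x + arctan ((k - 1) * P x))"
  let ?g = "\<lambda>x. (1 - a * (sin x)\<^sup>2) / (1 + (k\<^sup>2 - 1) * (sin x)\<^sup>2)\<^sup>2"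
  let ?F = "\<lambda>t::real. 2 / m * (\<alpha> / k * H (m * t / 2) + (1 - \<alpha>) * Q (m * t / 2))"
  have pos: "0 < (cos x)\<^sup>2 + l * (sin x)\<^sup>2" if "0 < l" for x l :: real
    using that sin_cos_squared_add[of x]
    by (cases "sin x = 0") (auto intro!: add_nonneg_pos)
  \<comment> \<open>Used with \<open>l = k\<close> for \<open>P\<close> and with
    \<open>l = k\<^sup>2\<close> for \<open>Q\<close>. The numerator simplifies because
    \<open>(cos x)\<^sup>2 + (sin x)\<^sup>2\<close> splits off as a factor.\<close>
  have d: "((\<lambda>x::real. sin x * cos x / ((cos x)\<^sup>2 + l * (sin x)\<^sup>2)) has_real_derivative
     ((cos x)\<^sup>2 - l * (sin x)\<^sup>2) / ((cos x)\<^sup>2 + l * (sin x)\<^sup>2)\<^sup>2) (at x)" if "0 < l" for x l :: real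
  proof -
    have nz: "(cos x)\<^sup>2 + l * (sin x)\<^sup>2 \<noteq> 0" using pos[OF that, of x] by simp
    have "((\<lambda>x::real. sin x * cos x / ((cos x)\<^sup>2 + l * (sin x)\<^sup>2)) has_real_derivative
      (((cos x)\<^sup>2 - (sin x)\<^sup>2) * ((cos x)\<^sup>2 + l * (sin x)\<^sup>2) - (sin x * cos x) * (2 * (l - 1) * sin x * cos x))
       / ((cos x)\<^sup>2 + l * (sin x)\<^sup>2)\<^sup>2) (at x)"
      using nz by (auto intro!: derivative_eq_intros simp: power2_eq_square algebra_simps)
    moreover have "(C\<^sup>2 - S\<^sup>2) * (C\<^sup>2 + l * S\<^sup>2) - (S * C) * (2 * (l - 1) * S * C)
       = (C\<^sup>2 - l * S\<^sup>2) * (C\<^sup>2 + S\<^sup>2)" for C S :: real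
      by (simp add: power2_eq_square algebra_simps)
    note this[of "cos x" "sin x"]
    ultimately show ?thesis by simp
  qed
  have den: "(cos x)\<^sup>2 + l * (sin x)\<^sup>2 = 1 + (l - 1) * (sin x)\<^sup>2" for x l :: real
    by (simp add: cos_squared_eq algebra_simps)
  have dH: "(H has_real_derivative k / ((cos x)\<^sup>2 + k\<^sup>2 * (sin x)\<^sup>2)) (at x)" for x
  proof -
    define C S u where "C = (cos x)\<^sup>2" and "S = (sin x)\<^sup>2" and "u = C + k * S"
    have CS: "C = 1 - S"
      unfolding C_def S_def by (rule cos_squared_eq)
    have u: "0 < u" unfolding u_def C_def S_def using assms(2) by (intro pos) auto
    have v: "0 < C + k\<^sup>2 * S" unfolding C_def S_def using assms(2) by (intro pos) auto
    have "(P has_real_derivative (C - k * S) / u\<^sup>2) (at x)"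
      unfolding P_def C_def S_def u_def using assms(2) by (intro d) auto
    then have "(H has_real_derivative 1 + inverse (1 + ((k - 1) * P x)\<^sup>2) * ((k - 1) * ((C - k * S) / u\<^sup>2))) (at x)"
      unfolding H_def by (intro DERIV_add DERIV_ident DERIV_chain2[OF DERIV_arctan] DERIV_cmult)
    moreover have "1 + ((k - 1) * P x)\<^sup>2 = (u\<^sup>2 + (k - 1)\<^sup>2 * C * S) / u\<^sup>2"
      using u unfolding P_def C_def[symmetric] S_def[symmetric] u_def[symmetric]
      by (simp add: power_mult_distrib power_divide add_divide_distrib C_def S_def)
    moreover have "u\<^sup>2 + (k - 1)\<^sup>2 * C * S = C + k\<^sup>2 * S"
      unfolding u_def CS by (simp add: power2_eq_square algebra_simps)
    moreover have "1 + inverse ((C + k\<^sup>2 * S) / u\<^sup>2) * ((k - 1) * ((C - k * S) / u\<^sup>2)) = k / (C + k\<^sup>2 * S)"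
      using u v by (simp add: divide_simps) (simp add: CS algebra_simps power2_eq_square)
    ultimately have "(H has_real_derivative k / (C + k\<^sup>2 * S)) (at x)"
      by (simp only:)
    then show ?thesis unfolding C_def S_def .
  qed
  have dQ: "(Q has_real_derivative ((cos x)\<^sup>2 - k\<^sup>2 * (sin x)\<^sup>2) / ((cos x)\<^sup>2 + k\<^sup>2 * (sin x)\<^sup>2)\<^sup>2) (at x)" for x
    unfolding Q_def using assms(2) by (intro d) auto
  have key: "\<alpha> / k * (k / ((cos x)\<^sup>2 + k\<^sup>2 * (sin x)\<^sup>2))
      + (1 - \<alpha>) * (((cos x)\<^sup>2 - k\<^sup>2 * (sin x)\<^sup>2) / ((cos x)\<^sup>2 + k\<^sup>2 * (sin x)\<^sup>2)\<^sup>2) = ?g x" for x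
  proof -
    define S v where "S = (sin x)\<^sup>2" and "v = 1 + (k\<^sup>2 - 1) * S"
    have c: "(cos x)\<^sup>2 = 1 - S"
      unfolding S_def by (rule cos_squared_eq)
    have v: "0 < v" using pos[of "k\<^sup>2" x] assms(2) unfolding v_def S_def den by simp
    have "\<alpha> * v + (1 - \<alpha>) * (1 - S - k\<^sup>2 * S) = 1 - a * S"
      using assms(2) unfolding \<alpha>_def v_def by (simp add: divide_simps) (simp add: algebra_simps power2_eq_square)
    then have "(1 - a * S) / v\<^sup>2 = \<alpha> * v / v\<^sup>2 + (1 - \<alpha>) * (1 - S - k\<^sup>2 * S) / v\<^sup>2"
      by (simp flip: add_divide_distrib)
    also have "\<dots> = \<alpha> / v + (1 - \<alpha>) * ((1 - S - k\<^sup>2 * S) / v\<^sup>2)"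
      using v by (simp add: power2_eq_square)
    finally show ?thesis
      using assms(2) unfolding den by (simp add: c flip: S_def v_def)
  qed
  have "(?F has_real_derivative ?g (m * t / 2)) (at t)" for t :: real
  proof -
    have i: "((\<lambda>t. m * t / 2) has_real_derivative m / 2) (at t)"
      by (auto intro!: derivative_eq_intros)
    have "(?F has_real_derivative 2 / m * (\<alpha> / k * (k / ((cos (m * t / 2))\<^sup>2 + k\<^sup>2 * (sin (m * t / 2))\<^sup>2) * (m / 2))
      + (1 - \<alpha>) * (((cos (m * t / 2))\<^sup>2 - k\<^sup>2 * (sin (m * t / 2))\<^sup>2) / ((cos (m * t / 2))\<^sup>2 + k\<^sup>2 * (sin (m * t / 2))\<^sup>2)\<^sup>2 * (m / 2)))) (at t)"
      by (intro DERIV_cmult DERIV_add DERIV_chain2[OF dH i] DERIV_chain2[OF dQ i])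
    also have "2 / m * (\<alpha> / k * (k / ((cos (m * t / 2))\<^sup>2 + k\<^sup>2 * (sin (m * t / 2))\<^sup>2) * (m / 2))
      + (1 - \<alpha>) * (((cos (m * t / 2))\<^sup>2 - k\<^sup>2 * (sin (m * t / 2))\<^sup>2) / ((cos (m * t / 2))\<^sup>2 + k\<^sup>2 * (sin (m * t / 2))\<^sup>2)\<^sup>2 * (m / 2)))
      = 2 / m * (m / 2 * ?g (m * t / 2))"
      unfolding key[symmetric] by (simp only: algebra_simps)
    also have "2 / m * (m / 2 * y) = y" for y :: real
      using assms(1) by simp
    finally show ?thesis .
  qed
  moreover have "1 + (k\<^sup>2 - 1) * (sin x)\<^sup>2 \<noteq> 0" for x
    using pos[of "k\<^sup>2" x] assms(2) unfolding den by auto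
  ultimately have "(\<integral>t. ?g (m * t / 2) \<partial>circle) = (?F pi - ?F (- pi)) / (2 * pi)"
    by (intro integral_circle_FTC) (auto intro!: continuous_intros)
  also have "?F pi - ?F (- pi) = 2 / m * (\<alpha> / k * (m * pi))"
  proof -
    have "sin (m * pi / 2) * cos (m * pi / 2) = 0"
      using cos_sin_pi_half_int[of m] by (simp only: mult.commute[of pi])
    moreover have "m * - pi / 2 = - (m * pi / 2)"
      by simp
    ultimately have "H (m * pi / 2) = m * pi / 2" "H (m * - pi / 2) = - (m * pi / 2)"
      "Q (m * pi / 2) = 0" "Q (m * - pi / 2) = 0"
      unfolding H_def P_def Q_def by simp_all
    then show ?thesis by (simp only:) (simp add: algebra_simps)
  qed
  also have "\<dots> / (2 * pi) = \<alpha> / k" using assms by simp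
  also have "\<dots> = (k\<^sup>2 + 1 - a) / (2 * k ^ 3)"
    by (simp add: \<alpha>_def power2_eq_square power3_eq_cube mult.assoc)
  finally show ?thesis .
qed

subsection \<open>Two-point laws\<close>

text \<open>The final comparison for \<open>p \<ge> 2\<close>, squared and cleared of denominators:
  there \<open>w = 2 * c - 1\<close>, and \<open>N\<close> is the square of the parameter
  \<open>k\<close> of the rational integrand.\<close>

lemma two_point_polynomial:
  fixes N w :: real
  assumes "1 \<le> N" "0 \<le> w" "w \<le> 1"
  shows "(N + w\<^sup>2)\<^sup>2 * (3 * (1 + w) ^ 3 + 2 * (3 + w) * (2 * N - 1 - w\<^sup>2)) \<le> 12 * N ^ 3 * (1 + w) ^ 3"
proof -
  \<comment> \<open>The Taylor coefficients of the difference at \<open>N = 1\<close> are nonnegative.\<close>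
  define b where "b = N - 1"
  have b: "0 \<le> b" and N: "N = 1 + b" using assms unfolding b_def by auto
  have le: "w ^ j \<le> w ^ i" if "i \<le> j" for i j
    using that assms by (intro power_decreasing) auto
  \<comment> \<open>Each negative power of \<open>w\<close> is absorbed by a lower one. The split
    \<open>25 = 11 + 13 + 1\<close> is exact, since equality holds at \<open>w = 1\<close>.\<close>
  have "0 \<le> 3 + 25 * w + 15 * w ^ 2 - 11 * w ^ 3 - 15 * w ^ 4 - 13 * w ^ 5 - 3 * w ^ 6 - w ^ 7"
    using le[of 2 4] le[of 1 3] le[of 1 5] le[of 1 7] le[of 0 6] by simp
  moreover have "0 \<le> 6 + 82 * w + 60 * w ^ 2 + 4 * w ^ 3 - 18 * w ^ 4 - 6 * w ^ 5"
    using le[of 2 4] le[of 1 5, simplified] zero_le_power[OF assms(2), of 3] zero_le_power2[of w] assms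
    by linarith
  then have "0 \<le> b * (6 + 82 * w + 60 * w ^ 2 + 4 * w ^ 3 - 18 * w ^ 4 - 6 * w ^ 5)"
    using b by (intro mult_nonneg_nonneg)
  moreover have "0 \<le> b ^ 2 * (3 + 89 * w + 81 * w ^ 2 + 27 * w ^ 3)"
    using assms by auto
  moreover have "0 \<le> b ^ 3 * (32 * w + 36 * w ^ 2 + 12 * w ^ 3)"
    using assms b by auto
  ultimately have "0 \<le> 3 + 25 * w + 15 * w ^ 2 - 11 * w ^ 3 - 15 * w ^ 4 - 13 * w ^ 5 - 3 * w ^ 6 - w ^ 7
      + b * (6 + 82 * w + 60 * w ^ 2 + 4 * w ^ 3 - 18 * w ^ 4 - 6 * w ^ 5)
      + b ^ 2 * (3 + 89 * w + 81 * w ^ 2 + 27 * w ^ 3) + b ^ 3 * (32 * w + 36 * w ^ 2 + 12 * w ^ 3)"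
    by linarith
  also have "\<dots> = 12 * N ^ 3 * (1 + w) ^ 3 - (N + w\<^sup>2)\<^sup>2 * (3 * (1 + w) ^ 3 + 2 * (3 + w) * (2 * N - 1 - w\<^sup>2))"
    unfolding N by algebra
  finally show ?thesis by simp
qed

text \<open>With \<open>z = 1 - a s\<close>, \<open>s = sin\<^sup>2 (m t / 2)\<close>, the right-hand side has an elementary mean over \<open>t\<close>.\<close>

lemma powr_le_rational:
  fixes z q :: real
  assumes "0 \<le> z" "1 \<le> q"  "z \<le> 1"
  shows "z powr q \<le> z / (1 + (q - 1) / 2 * (1 - z))\<^sup>2"
proof (cases "z = 0")
  case False
  \<comment> \<open>Then \<open>q = 1 + 2 * r\<close>, so \<open>z powr q\<close> is
    \<open>z / (z powr (- r))\<^sup>2\<close> and a lower bound for \<open>z powr (- r)\<close>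
    suffices.\<close>
  define r where "r = (q - 1) / 2"
  have z: "0 < z" and r: "0 \<le> r" using assms False by (auto simp: r_def)
  have "r * (1 - z) \<le> r * - ln z"
    using r ln_le_minus_one[OF z] by (intro mult_left_mono) auto
  then have "1 + r * (1 - z) \<le> exp (- r * ln z)"
    using exp_ge_add_one_self[of "- r * ln z"] by simp
  also have "\<dots> = z powr (- r)" using z by (simp add: powr_def)
  finally have "(1 + r * (1 - z))\<^sup>2 \<le> (z powr (- r))\<^sup>2"
    using r assms by (intro power_mono) auto
  moreover have "0 < 1 + r * (1 - z)"
    using r assms by (intro add_pos_nonneg) auto
  ultimately have "z / (z powr (- r))\<^sup>2 \<le> z / (1 + r * (1 - z))\<^sup>2"
    using z by (intro divide_left_mono) auto
  moreover have "z / (z powr (- r))\<^sup>2 = z powr q"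
    using z by (simp add: r_def power2_eq_square field_simps flip: powr_add powr_minus)
  ultimately show ?thesis by (simp add: r_def)
qed simp

lemma integral_circle_two_point_le_2:
  fixes c p :: real and m :: int
  assumes "1 / 2 \<le> c" "c \<le> 1" "1 \<le> p" "p \<le> 2" "m \<noteq> 0"
  shows "(\<integral>t. (1 - 4 * c * (1 - c) * (sin (m * t / 2))\<^sup>2) powr (p / 2) \<partial>circle)
    \<le> 1 / sqrt (1 + p * (1 / c\<^sup>2 - 1) / 3)"
proof -
  define a \<mu> r where "a = 4 * c * (1 - c)" and "\<mu> = 1 - a / 2" and "r = p / 2"
  have a: "0 \<le> a" "a \<le> 1"
    using assms zero_le_power2[of "2 * c - 1"] by (auto simp: a_def power2_eq_square algebra_simps)
  have \<mu>: "0 < \<mu>" using a by (simp add: \<mu>_def)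
  have r: "0 \<le> r" "r \<le> 1" using assms by (auto simp: r_def)
  \<comment> \<open>\<open>?A + ?B * s\<close> is the tangent line of
    \<open>(1 - a * s) powr r\<close> at \<open>s = 1 / 2\<close>. As \<open>sin\<^sup>2\<close> has
    mean 1/2, the line has mean \<open>\<mu> powr r\<close>.\<close>
  let ?A = "\<mu> powr r * (1 + r * (1 / \<mu> - 1))" and ?B = "- (\<mu> powr r * r * a / \<mu>)"
  have le: "(1 - a * s) powr r \<le> ?A + ?B * s" if "0 \<le> s" "s \<le> 1" for s
  proof -
    have z: "0 \<le> 1 - a * s" using a that by (simp add: mult_le_one)
    have "((1 - a * s) / \<mu>) powr r \<le> 1 + r * ((1 - a * s) / \<mu> - 1)"
      using z \<mu> r by (intro bernoulli_powr_le) auto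
    then have "\<mu> powr r * ((1 - a * s) / \<mu>) powr r \<le> \<mu> powr r * (1 + r * ((1 - a * s) / \<mu> - 1))"
      by (intro mult_left_mono) auto
    moreover have "\<mu> powr r * ((1 - a * s) / \<mu>) powr r = (1 - a * s) powr r"
      using z \<mu> by (simp flip: powr_mult)
    moreover have "\<mu> powr r * (1 + r * ((1 - a * s) / \<mu> - 1)) = ?A + ?B * s"
      by (simp add: diff_divide_distrib algebra_simps)
    ultimately show ?thesis by simp
  qed
  interpret prob_space circle by (rule prob_space_circle)
  have "(\<integral>t. (1 - a * (sin (m * t / 2))\<^sup>2) powr r \<partial>circle) \<le> (\<integral>t. ?A + ?B * (sin (m * t / 2))\<^sup>2 \<partial>circle)"
  proof (intro integral_mono)
    show "integrable circle (\<lambda>t. (1 - a * (sin (m * t / 2))\<^sup>2) powr r)"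
      using a r by (intro integrable_circle_bounded[where B = 1])
        (auto simp: mult_le_one abs_square_le_1 intro!: powr_le1)
    show "integrable circle (\<lambda>t. ?A + ?B * (sin (m * t / 2))\<^sup>2)"
      using integrable_circle_bounded[of "\<lambda>t. (sin (m * t / 2))\<^sup>2" 1] by (simp add: abs_square_le_1)
    show "(1 - a * (sin (m * t / 2))\<^sup>2) powr r \<le> ?A + ?B * (sin (m * t / 2))\<^sup>2" for t :: real
      by (intro le) (auto simp: abs_square_le_1)
  qed
  also have "\<dots> = ?A + ?B / 2"
    using assms by (intro integral_circle_sin_squared)
  also have "\<dots> = \<mu> powr r"
    using \<mu> by (simp add: field_simps) (simp add: \<mu>_def algebra_simps)
  also have "\<mu> powr r = 1 / sqrt ((1 / \<mu>) powr p)"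
    using \<mu> by (simp add: r_def powr_half_sqrt[symmetric] powr_powr powr_divide)
  also have "\<dots> \<le> 1 / sqrt (1 + p * (1 / c\<^sup>2 - 1) / 3)"
  proof -
    have \<mu>': "\<mu> = 1 - 2 * c + 2 * c * c" by (simp add: \<mu>_def a_def field_simps)
    \<comment> \<open>The factor \<open>2 * c - 1\<close> is where \<open>c \<ge> 1 / 2\<close>
      enters. Equality at \<open>c = 1 / 2\<close> shows that 1/3 is the largest constant this
      comparison allows.\<close>
    have "1 / \<mu> - 1 - (1 / c\<^sup>2 - 1) / 3 = (1 - c) * ((2 * c - 1) * (2 * c\<^sup>2 + c + 1)) / (3 * c\<^sup>2 * \<mu>)"
      using assms \<mu> by (simp add: divide_simps) (simp add: \<mu>' power2_eq_square algebra_simps)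
    also have "0 \<le> \<dots>"
      using assms \<mu> by (intro divide_nonneg_nonneg mult_nonneg_nonneg) auto
    finally have "(1 / c\<^sup>2 - 1) / 3 \<le> 1 / \<mu> - 1" by simp
    then have "1 + p * ((1 / c\<^sup>2 - 1) / 3) \<le> 1 + p * (1 / \<mu> - 1)"
      using assms by (intro add_left_mono mult_left_mono) auto
    also have "\<dots> \<le> (1 / \<mu>) powr p"
      using assms \<mu> by (intro bernoulli_powr_ge) auto
    finally have "1 + p * (1 / c\<^sup>2 - 1) / 3 \<le> (1 / \<mu>) powr p" by simp
    moreover have "0 < 1 + p * (1 / c\<^sup>2 - 1) / 3"
      using assms by (intro add_pos_nonneg) (auto simp: power_le_one)
    ultimately show ?thesis using \<mu> by (intro divide_left_mono) auto
  qed
  finally show ?thesis unfolding a_def r_def .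
qed

lemma integral_circle_two_point_ge_2:
  fixes c p :: real and m :: int
  assumes "1 / 2 \<le> c" "c \<le> 1" "2 \<le> p" "m \<noteq> 0"
  shows "(\<integral>t. (1 - 4 * c * (1 - c) * (sin (m * t / 2))\<^sup>2) powr (p / 2) \<partial>circle)
    \<le> 1 / sqrt (1 + p * (1 / c\<^sup>2 - 1) / 3)"
proof -
  define a w q where "a = 4 * c * (1 - c)" and "w = 2 * c - 1" and "q = p / 2"
  \<comment> \<open>With this \<open>N\<close>, the denominator of \<open>powr_le_rational\<close>
    at \<open>z = 1 - a * s\<close> is the square of \<open>1 + (N - 1) * s\<close>, the shape that
    \<open>integral_circle_rational\<close> integrates with \<open>k\<^sup>2 = N\<close>.\<close>
  define N k where "N = 1 + (q - 1) / 2 * a" and "k = sqrt N"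
  have a: "0 \<le> a" "a \<le> 1"
    using assms zero_le_power2[of "2 * c - 1"] by (auto simp: a_def power2_eq_square algebra_simps)
  have aw: "1 - a = w\<^sup>2" by (simp add: a_def w_def power2_eq_square algebra_simps)
  have N: "1 \<le> N" using assms a by (simp add: N_def q_def)
  have k: "1 \<le> k" "k\<^sup>2 = N" using N by (auto simp: k_def)
  have s: "0 \<le> 1 - a * s" "1 - a * s \<le> 1" "1 \<le> 1 + (k\<^sup>2 - 1) * s" if "0 \<le> s" "s \<le> 1" for s
    using a that N k by (auto simp: mult_le_one)
  have "(\<integral>t. (1 - a * (sin (m * t / 2))\<^sup>2) powr q \<partial>circle)
      \<le> (\<integral>t. (1 - a * (sin (m * t / 2))\<^sup>2) / (1 + (k\<^sup>2 - 1) * (sin (m * t / 2))\<^sup>2)\<^sup>2 \<partial>circle)"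
  proof (intro integral_mono)
    show "integrable circle (\<lambda>t. (1 - a * (sin (m * t / 2))\<^sup>2) powr q)"
      using s assms by (intro integrable_circle_bounded[where B = 1])
        (auto simp: abs_square_le_1 q_def intro!: powr_le1)
    show "integrable circle (\<lambda>t. (1 - a * (sin (m * t / 2))\<^sup>2) / (1 + (k\<^sup>2 - 1) * (sin (m * t / 2))\<^sup>2)\<^sup>2)"
    proof (intro integrable_circle_bounded[where B = 1])
      fix t :: real
      let ?s = "(sin (m * t / 2))\<^sup>2"
      have "1 \<le> (1 + (k\<^sup>2 - 1) * ?s)\<^sup>2"
        using s(3)[of ?s] by (intro one_le_power) (auto simp: abs_square_le_1)
      then show "\<bar>(1 - a * ?s) / (1 + (k\<^sup>2 - 1) * ?s)\<^sup>2\<bar> \<le> 1"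
        using s(1,2)[of ?s] by (auto simp: abs_square_le_1 abs_divide divide_le_eq_1)
    qed auto
    fix t :: real
    let ?s = "(sin (m * t / 2))\<^sup>2"
    have "(1 - a * ?s) powr q \<le> (1 - a * ?s) / (1 + (q - 1) / 2 * (1 - (1 - a * ?s)))\<^sup>2"
      using s assms by (intro powr_le_rational) (auto simp: abs_square_le_1 q_def)
    also have "1 + (q - 1) / 2 * (1 - (1 - a * ?s)) = 1 + (k\<^sup>2 - 1) * ?s"
      by (simp add: k N_def)
    finally show "(1 - a * ?s) powr q \<le> (1 - a * ?s) / (1 + (k\<^sup>2 - 1) * ?s)\<^sup>2" .
  qed
  also have "\<dots> = (N + w\<^sup>2) / (2 * k ^ 3)"
    using integral_circle_rational[OF assms(4) k(1), of a] aw k by (simp add: add_diff_eq[symmetric])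
  also have "\<dots> \<le> 1 / sqrt (1 + p * (1 / c\<^sup>2 - 1) / 3)"
  proof -
    define E where "E = 1 + p * (1 / c\<^sup>2 - 1) / 3"
    have E: "0 < E" unfolding E_def
      using assms by (intro add_pos_nonneg) (auto simp: power_le_one)
    have w: "0 \<le> w" "w \<le> 1" "c = (1 + w) / 2" using assms by (auto simp: w_def)
    have pa: "p * a = 2 * (2 * N - 1 - w\<^sup>2)"
      unfolding aw[symmetric] N_def q_def by (simp add: field_simps)
    \<comment> \<open>Clearing the denominator of \<open>E\<close> takes only
      \<open>(1 + w)\<^sup>2\<close>. The third factor turns \<open>1 - w\<close> into
      \<open>a\<close>, and \<open>pa\<close> then leaves an expression in \<open>N\<close> and
      \<open>w\<close> alone.\<close>
    have "3 * (1 + w) ^ 3 * E = 3 * (1 + w) ^ 3 + p * ((1 - w) * (1 + w)) * (3 + w)"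
      using w(1) unfolding E_def w(3)
      by (simp add: divide_simps) (simp add: algebra_simps power2_eq_square power3_eq_cube)
    also have "(1 - w) * (1 + w) = a" using aw by (simp add: power2_eq_square algebra_simps)
    finally have "3 * (1 + w) ^ 3 * E = 3 * (1 + w) ^ 3 + 2 * (3 + w) * (2 * N - 1 - w\<^sup>2)"
      unfolding pa by (simp add: algebra_simps)
    then have "3 * (1 + w) ^ 3 * ((N + w\<^sup>2)\<^sup>2 * E) \<le> 3 * (1 + w) ^ 3 * (4 * N ^ 3)"
      using two_point_polynomial[OF N w(1,2)]
      by (simp only: mult.left_commute[of _ "(N + w\<^sup>2)\<^sup>2"]) (simp add: mult_ac)
    then have "(N + w\<^sup>2)\<^sup>2 * E \<le> 4 * N ^ 3"
      using w by (subst (asm) mult_le_cancel_left_pos) auto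
    also have "4 * N ^ 3 = (2 * k ^ 3)\<^sup>2"
      by (simp add: k(2)[symmetric] power_mult_distrib flip: power_mult)
    also have "(N + w\<^sup>2)\<^sup>2 * E = ((N + w\<^sup>2) * sqrt E)\<^sup>2"
      using E by (simp add: power_mult_distrib)
    finally have "(N + w\<^sup>2) * sqrt E \<le> 2 * k ^ 3"
      by (rule power2_le_imp_le) (use k(1) in simp)
    moreover have "0 < 2 * k ^ 3" using k(1) by simp
    ultimately show ?thesis
      using E unfolding E_def[symmetric] by (simp add: pos_divide_le_eq pos_le_divide_eq mult.commute)
  qed
  finally show ?thesis unfolding a_def q_def .
qed

lemma integral_circle_two_point:
  fixes c p :: real and m :: int
  assumes "1 / 2 \<le> c" "c \<le> 1" "1 \<le> p" "m \<noteq> 0"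
  shows "(\<integral>t. (1 - 4 * c * (1 - c) * (sin (m * t / 2))\<^sup>2) powr (p / 2) \<partial>circle)
    \<le> 1 / sqrt (1 + p * (1 / c\<^sup>2 - 1) / 3)"
  using integral_circle_two_point_le_2 integral_circle_two_point_ge_2 assms by (cases "p \<le> 2") auto

text \<open>The left side is the modulus of the characteristic function of a two-point law with its
  first atom shifted to 0. Its square is
  \<open>c\<^sup>2 + 2 * c * (1 - c) * cos \<theta> + (1 - c)\<^sup>2\<close>, and the half-angle
  formula does the rest.\<close>

lemma cmod_two_point:
  "cmod (of_real c + of_real (1 - c) * iexp \<theta>) = sqrt (1 - 4 * c * (1 - c) * (sin (\<theta> / 2))\<^sup>2)"
proof -
  have "(c + (1 - c) * C)\<^sup>2 + ((1 - c) * S)\<^sup>2 = 1 - 4 * c * (1 - c) * \<sigma>"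
    if "C = 1 - 2 * \<sigma>" "S\<^sup>2 + C\<^sup>2 = 1" for C S \<sigma> :: real
  proof -
    have "(c + (1 - c) * C)\<^sup>2 + ((1 - c) * S)\<^sup>2 = c\<^sup>2 + 2 * c * (1 - c) * C + (1 - c)\<^sup>2 * (S\<^sup>2 + C\<^sup>2)"
      by (simp add: power2_eq_square algebra_simps)
    also have "\<dots> = 1 - 4 * c * (1 - c) * \<sigma>"
      unfolding that(2) unfolding that(1) by (simp add: power2_eq_square algebra_simps)
    finally show ?thesis .
  qed
  moreover have "cos \<theta> = 1 - 2 * (sin (\<theta> / 2))\<^sup>2"
    using cos_double_sin[of "\<theta> / 2"] by simp
  ultimately have "(c + (1 - c) * cos \<theta>)\<^sup>2 + ((1 - c) * sin \<theta>)\<^sup>2 = 1 - 4 * c * (1 - c) * (sin (\<theta> / 2))\<^sup>2"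
    using sin_cos_squared_add by blast
  then show ?thesis
    by (simp add: cmod_def flip: cis_conv_exp)
qed

subsection \<open>Characteristic functions of integer-valued variables\<close>

text \<open>Jensen's inequality for the law conditioned on \<open>A\<close>, combined with
  monotonicity: \<open>m\<close> may be any lower bound of the conditional mean. The tangent of the
  power at \<open>m\<close> lies below it and has nonnegative slope.\<close>

lemma (in prob_space) powr_integral_le:
  fixes g :: "'a \<Rightarrow> real"
  assumes [measurable]: "A \<in> events" "g \<in> borel_measurable M"
    and A: "0 < prob A" and g: "\<And>\<omega>. 0 \<le> g \<omega>" "\<And>\<omega>. g \<omega> \<le> 1"
    and m: "0 \<le> m" "m \<le> (\<integral>\<omega>. indicator A \<omega> * g \<omega> \<partial>M) / prob A" and p: "1 \<le> p"
  shows "m powr p \<le> (\<integral>\<omega>. indicator A \<omega> * g \<omega> powr p \<partial>M) / prob A"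
proof (cases "m = 0")
  case True
  then show ?thesis by (auto intro!: divide_nonneg_nonneg integral_nonneg_AE)
next
  case False
  then have mpos: "0 < m" using m by simp
  have tangent: "m powr p * (1 + p * (g \<omega> / m - 1)) \<le> g \<omega> powr p" for \<omega>
  proof -
    have "m powr p * (1 + p * (g \<omega> / m - 1)) \<le> m powr p * (g \<omega> / m) powr p"
      using g mpos p by (intro mult_left_mono bernoulli_powr_ge) auto
    then show ?thesis using g mpos by (simp add: powr_divide)
  qed
  have i1: "integrable M (\<lambda>\<omega>. indicator A \<omega> * g \<omega>)"
    using g by (intro integrable_const_bound[where B = 1]) (auto split: split_indicator)
  have i2: "integrable M (\<lambda>\<omega>. indicator A \<omega> * g \<omega> powr p)"
    using g p by (intro integrable_const_bound[where B = 1])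
      (auto split: split_indicator intro!: powr_le1)
  have i0: "integrable M (indicator A :: 'a \<Rightarrow> real)"
    by (intro integrable_const_bound[where B = 1]) (auto split: split_indicator)
  define I where "I = (\<integral>\<omega>. indicator A \<omega> * g \<omega> \<partial>M)"
  have I: "m * prob A \<le> I" using m(2) A by (simp add: I_def field_simps)
  have "m powr p * prob A \<le> m powr p * ((1 - p) * prob A + p / m * I)"
  proof (intro mult_left_mono)
    have "p / m * (m * prob A) \<le> p / m * I" using I p mpos by (intro mult_left_mono) auto
    then show "prob A \<le> (1 - p) * prob A + p / m * I" using mpos by (simp add: algebra_simps)
  qed simp
  also have "\<dots> = (\<integral>\<omega>. m powr p * ((1 - p) * indicator A \<omega> + p / m * (indicator A \<omega> * g \<omega>)) \<partial>M)"
    using i0 i1 by (simp add: I_def)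
  also have "\<dots> \<le> (\<integral>\<omega>. indicator A \<omega> * g \<omega> powr p \<partial>M)"
  proof (intro integral_mono i2)
    show "integrable M (\<lambda>\<omega>. m powr p * ((1 - p) * indicator A \<omega> + p / m * (indicator A \<omega> * g \<omega>)))"
      by (intro integrable_mult_right Bochner_Integration.integrable_add i0 i1)
    show "m powr p * ((1 - p) * indicator A \<omega> + p / m * (indicator A \<omega> * g \<omega>)) \<le> indicator A \<omega> * g \<omega> powr p" for \<omega>
      using tangent[of \<omega>] by (auto split: split_indicator simp: algebra_simps)
  qed
  finally show ?thesis using A by (simp add: field_simps)
qed

lemma (in prob_space) char_of_int:
  fixes X :: "'a \<Rightarrow> int"
  assumes [measurable]: "X \<in> measurable M (count_space UNIV)"
  shows "char (distr M borel (\<lambda>\<omega>. real_of_int (X \<omega>))) t = (CLINT \<omega>|M. iexp (t * X \<omega>))"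
  by (simp add: char_def integral_distr)

text \<open>The shift multiplies by a constant of modulus 1. It serves to move the point
  \<open>k\<close> to 0.\<close>

lemma (in prob_space) norm_char_shift:
  fixes X :: "'a \<Rightarrow> int"
  assumes [measurable]: "X \<in> measurable M (count_space UNIV)"
  shows "cmod (char (distr M borel (\<lambda>\<omega>. real_of_int (X \<omega>))) t) = cmod (CLINT \<omega>|M. iexp (t * (X \<omega> - k)))"
proof -
  have "(CLINT \<omega>|M. iexp (t * (X \<omega> - k))) = (CLINT \<omega>|M. iexp (- t * k) * iexp (t * X \<omega>))"
    by (intro Bochner_Integration.integral_cong) (auto simp: algebra_simps simp flip: exp_add)
  also have "\<dots> = iexp (- t * k) * char (distr M borel (\<lambda>\<omega>. real_of_int (X \<omega>))) t"
    by (simp add: char_of_int)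
  finally show ?thesis by (simp add: norm_mult del: of_real_mult)
qed

text \<open>The indicator of \<open>X = k\<close> is the circle mean of
  \<open>cos (t * (X - k))\<close>. After Fubini, the inner integral is the real part of a shifted
  characteristic function, hence at most its modulus.\<close>

lemma (in prob_space) prob_fun_le_integral_char:
  fixes X :: "'a \<Rightarrow> int"
  assumes [measurable]: "X \<in> measurable M (count_space UNIV)"
  shows "prob_fun M X k \<le> (\<integral>t. cmod (char (distr M borel (\<lambda>\<omega>. real_of_int (X \<omega>))) t) \<partial>circle)"
proof -
  interpret C: prob_space circle by (rule prob_space_circle)
  interpret P: pair_prob_space M circle ..
  interpret D: real_distribution "distr M borel (\<lambda>\<omega>. real_of_int (X \<omega>))" by simp
  have "prob_fun M X k = (\<integral>\<omega>. indicator {\<omega> \<in> space M. X \<omega> = k} \<omega> \<partial>M)"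
    by (simp add: prob_fun_def)
  also have "\<dots> = (\<integral>\<omega>. (\<integral>t. cos (t * of_int (X \<omega> - k)) \<partial>circle) \<partial>M)"
    by (intro Bochner_Integration.integral_cong refl) (simp only: integral_circle_cos, simp)
  also have "\<dots> = (\<integral>t. (\<integral>\<omega>. cos (t * of_int (X \<omega> - k)) \<partial>M) \<partial>circle)"
    by (intro P.Fubini_integral[symmetric] P.integrable_const_bound[where B = 1]) auto
  also have "\<dots> \<le> (\<integral>t. cmod (char (distr M borel (\<lambda>\<omega>. real_of_int (X \<omega>))) t) \<partial>circle)"
  proof (intro integral_mono)
    have *: "(\<integral>\<omega>. cos (t * of_int (X \<omega> - k)) \<partial>M) = Re (CLINT \<omega>|M. iexp (t * (X \<omega> - k)))" for t :: real
      by (subst integral_Re[symmetric])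
        (auto intro!: integrable_const_bound[where B = 1] simp: Re_exp)
    show "(\<integral>\<omega>. cos (t * of_int (X \<omega> - k)) \<partial>M) \<le> cmod (char (distr M borel (\<lambda>\<omega>. real_of_int (X \<omega>))) t)" for t :: real
      unfolding norm_char_shift[OF assms, of t k] * by (rule complex_Re_le_cmod)
    show "integrable circle (\<lambda>t. \<integral>\<omega>. cos (t * of_int (X \<omega> - k)) \<partial>M)"
      by (intro P.integrable_snd P.integrable_const_bound[where B = 1]) auto
    show "integrable circle (\<lambda>t. cmod (char (distr M borel (\<lambda>\<omega>. real_of_int (X \<omega>))) t))"
      by (intro integrable_circle_bounded[where B = 1]) (auto intro: D.cmod_char_le_1)
  qed
  finally show ?thesis .
qed

text \<open>The law of \<open>X\<close> is the mixture, over \<open>j \<noteq> k\<close> with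
  weights \<open>P(X = j) / (1 - c)\<close>, of the laws with mass \<open>c\<close> at
  \<open>k\<close> and \<open>1 - c\<close> at \<open>j\<close>. The triangle inequality bounds the
  modulus by the mixed moduli.\<close>

lemma (in prob_space) norm_char_le_mixture:
  fixes X :: "'a \<Rightarrow> int"
  assumes [measurable]: "X \<in> measurable M (count_space UNIV)"
    and c: "prob_fun M X k = c" "c < 1"
  shows "cmod (char (distr M borel (\<lambda>\<omega>. real_of_int (X \<omega>))) t)
    \<le> (\<integral>\<omega>. indicator {\<omega> \<in> space M. X \<omega> \<noteq> k} \<omega> *
          sqrt (1 - 4 * c * (1 - c) * (sin (of_int (X \<omega> - k) * t / 2))\<^sup>2) \<partial>M) / (1 - c)"
proof -
  let ?A = "{\<omega> \<in> space M. X \<omega> \<noteq> k}" and ?B = "{\<omega> \<in> space M. X \<omega> = k}"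
  let ?e = "\<lambda>\<omega>. iexp (t * (X \<omega> - k))"
  have B: "prob ?B = c" using c by (simp add: prob_fun_def)
  have "prob ?A = prob (space M - ?B)" by (intro arg_cong[where f = prob]) auto
  then have A: "prob ?A = 1 - c" using B by (simp add: prob_compl)
  have iA0: "integrable M (\<lambda>\<omega>. complex_of_real (indicator ?A \<omega>))"
    by (intro integrable_const_bound[where B = 1]) (auto split: split_indicator)
  have int0: "(CLINT \<omega>|M. complex_of_real (indicator ?A \<omega>)) = of_real (prob ?A)"
    by simp
  have iA: "integrable M (\<lambda>\<omega>. indicator ?A \<omega> *\<^sub>R ?e \<omega>)"
    by (intro integrable_const_bound[where B = 1]) (auto split: split_indicator)
  have "(CLINT \<omega>|M. ?e \<omega>) = (CLINT \<omega>|M. complex_of_real (indicator ?B \<omega>) + indicator ?A \<omega> *\<^sub>R ?e \<omega>)"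
    by (intro Bochner_Integration.integral_cong) (auto split: split_indicator)
  also have "\<dots> = of_real (prob ?B) + (CLINT \<omega>|M. indicator ?A \<omega> *\<^sub>R ?e \<omega>)"
    using iA by (subst Bochner_Integration.integral_add) (auto intro!: integrable_const_bound[where B = 1] split: split_indicator)
  \<comment> \<open>Scaling by \<open>1 - c = prob ?A\<close> lets the atom be spread over
    \<open>?A\<close>: \<open>c * prob ?A\<close> is the integral of \<open>c\<close> over
    \<open>?A\<close>, so the integrand there becomes a two-point characteristic function.\<close>
  finally have "of_real (1 - c) * (CLINT \<omega>|M. ?e \<omega>)
      = of_real c * of_real (prob ?A) + of_real (1 - c) * (CLINT \<omega>|M. indicator ?A \<omega> *\<^sub>R ?e \<omega>)"
    unfolding A B by (simp add: algebra_simps)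
  also have "\<dots> = (CLINT \<omega>|M. of_real c * of_real (indicator ?A \<omega>) + of_real (1 - c) * (indicator ?A \<omega> *\<^sub>R ?e \<omega>))"
    using integrable_mult_right[OF iA0] integrable_mult_right[OF iA]
    by (subst Bochner_Integration.integral_add) (simp_all only: integral_mult_right_zero int0)
  also have "cmod \<dots> \<le> (\<integral>\<omega>. cmod (of_real c * of_real (indicator ?A \<omega>) + of_real (1 - c) * (indicator ?A \<omega> *\<^sub>R ?e \<omega>)) \<partial>M)"
    by (rule integral_norm_bound)
  also have "\<dots> = (\<integral>\<omega>. indicator ?A \<omega> * sqrt (1 - 4 * c * (1 - c) * (sin (of_int (X \<omega> - k) * t / 2))\<^sup>2) \<partial>M)"
  proof (intro Bochner_Integration.integral_cong refl)
    show "cmod (of_real c * of_real (indicator ?A \<omega>) + of_real (1 - c) * (indicator ?A \<omega> *\<^sub>R ?e \<omega>))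
      = indicator ?A \<omega> * sqrt (1 - 4 * c * (1 - c) * (sin (of_int (X \<omega> - k) * t / 2))\<^sup>2)" for \<omega>
      using cmod_two_point[of c "t * (X \<omega> - k)"]
      by (cases "\<omega> \<in> ?A") (simp_all add: mult.commute[of t])
  qed
  finally have "(1 - c) * cmod (CLINT \<omega>|M. ?e \<omega>)
      \<le> (\<integral>\<omega>. indicator ?A \<omega> * sqrt (1 - 4 * c * (1 - c) * (sin (of_int (X \<omega> - k) * t / 2))\<^sup>2) \<partial>M)"
    using c by (simp add: norm_mult del: of_real_diff)
  then show ?thesis
    using c unfolding norm_char_shift[OF assms(1), of t k] by (simp add: field_simps)
qed

text \<open>Jensen moves the power inside the mixture and Fubini puts the circle mean innermost.
  There \<open>X \<omega> - k\<close> is a fixed nonzero integer, and the two-point bound does not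
  depend on which one.\<close>

lemma (in prob_space) integral_circle_char_powr_le:
  fixes X :: "'a \<Rightarrow> int"
  assumes X [measurable]: "X \<in> measurable M (count_space UNIV)"
    and c: "prob_fun M X k = c" "1 / 2 \<le> c" "c < 1" and p: "1 \<le> p"
  shows "(\<integral>t. cmod (char (distr M borel (\<lambda>\<omega>. real_of_int (X \<omega>))) t) powr p \<partial>circle)
    \<le> 1 / sqrt (1 + p * (1 / c\<^sup>2 - 1) / 3)"
proof -
  interpret C: prob_space circle by (rule prob_space_circle)
  interpret P: pair_prob_space M circle ..
  interpret D: real_distribution "distr M borel (\<lambda>\<omega>. real_of_int (X \<omega>))" by simp
  let ?A = "{\<omega> \<in> space M. X \<omega> \<noteq> k}" and ?B = "1 / sqrt (1 + p * (1 / c\<^sup>2 - 1) / 3)"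
  define h where "h m t = 1 - 4 * c * (1 - c) * (sin (m * t / 2))\<^sup>2" for m :: int and t :: real
  have [measurable]: "(\<lambda>(\<omega>, t). h (X \<omega> - k) t) \<in> borel_measurable (M \<Otimes>\<^sub>M circle)"
    "\<And>t. (\<lambda>\<omega>. h (X \<omega> - k) t) \<in> borel_measurable M"
    unfolding h_def by measurable
  have a: "0 \<le> 4 * c * (1 - c)" "4 * c * (1 - c) \<le> 1"
    using c zero_le_power2[of "2 * c - 1"] by (auto simp: power2_eq_square algebra_simps)
  have h: "0 \<le> h m t" "h m t \<le> 1" for m t
    using a mult_le_one[of "4 * c * (1 - c)" "(sin (m * t / 2))\<^sup>2"]
    unfolding h_def by (auto simp: abs_square_le_1)
  have "prob ?A = prob (space M - {\<omega> \<in> space M. X \<omega> = k})" by (intro arg_cong[where f = prob]) auto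
  then have A: "prob ?A = 1 - c" using c(1) by (simp add: prob_compl prob_fun_def)
  have int: "integrable (M \<Otimes>\<^sub>M circle) (\<lambda>(\<omega>, t). indicator ?A \<omega> * h (X \<omega> - k) t powr (p / 2))"
  proof (intro P.integrable_const_bound[where B = 1])
    show "AE x in M \<Otimes>\<^sub>M circle. norm (case x of (\<omega>, t) \<Rightarrow> indicator ?A \<omega> * h (X \<omega> - k) t powr (p / 2)) \<le> 1"
      using h p by (intro AE_I2) (auto split: split_indicator intro!: powr_le1)
    have "(\<lambda>x. indicator ?A (fst x) * (case x of (\<omega>, t) \<Rightarrow> h (X \<omega> - k) t) powr (p / 2))
        \<in> borel_measurable (M \<Otimes>\<^sub>M circle)"
      by measurable
    then show "(\<lambda>(\<omega>, t). indicator ?A \<omega> * h (X \<omega> - k) t powr (p / 2)) \<in> borel_measurable (M \<Otimes>\<^sub>M circle)"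
      by (simp add: case_prod_beta')
  qed
  have "(\<integral>t. cmod (char (distr M borel (\<lambda>\<omega>. real_of_int (X \<omega>))) t) powr p \<partial>circle)
      \<le> (\<integral>t. (\<integral>\<omega>. indicator ?A \<omega> * h (X \<omega> - k) t powr (p / 2) \<partial>M) / (1 - c) \<partial>circle)"
  proof (intro integral_mono)
    show "integrable circle (\<lambda>t. cmod (char (distr M borel (\<lambda>\<omega>. real_of_int (X \<omega>))) t) powr p)"
      using p by (intro integrable_circle_bounded[where B = 1]) (auto intro!: D.cmod_char_le_1 powr_le1)
    show "integrable circle (\<lambda>t. (\<integral>\<omega>. indicator ?A \<omega> * h (X \<omega> - k) t powr (p / 2) \<partial>M) / (1 - c))"
      using P.integrable_snd[OF int] by simp
    fix t :: real
    have "sqrt (h m t) powr p = h m t powr (p / 2)" for m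
      using h[of m t] by (simp add: powr_half_sqrt[symmetric] powr_powr)
    moreover have "cmod (char (distr M borel (\<lambda>\<omega>. real_of_int (X \<omega>))) t) powr p
      \<le> (\<integral>\<omega>. indicator ?A \<omega> * sqrt (h (X \<omega> - k) t) powr p \<partial>M) / prob ?A"
      using norm_char_le_mixture[OF X c(1,3), of t, folded h_def] h p c
      by (intro powr_integral_le) (simp_all add: A)
    ultimately show "cmod (char (distr M borel (\<lambda>\<omega>. real_of_int (X \<omega>))) t) powr p
      \<le> (\<integral>\<omega>. indicator ?A \<omega> * h (X \<omega> - k) t powr (p / 2) \<partial>M) / (1 - c)"
      by (simp add: A)
  qed
  also have "\<dots> = (\<integral>t. (\<integral>\<omega>. indicator ?A \<omega> * h (X \<omega> - k) t powr (p / 2) \<partial>M) \<partial>circle) / (1 - c)"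
    by simp
  also have "\<dots> = (\<integral>\<omega>. (\<integral>t. indicator ?A \<omega> * h (X \<omega> - k) t powr (p / 2) \<partial>circle) \<partial>M) / (1 - c)"
    using P.Fubini_integral[OF int] by simp
  also have "\<dots> \<le> (\<integral>\<omega>. indicator ?A \<omega> * ?B \<partial>M) / (1 - c)"
  proof (intro divide_right_mono integral_mono)
    show "integrable M (\<lambda>\<omega>. \<integral>t. indicator ?A \<omega> * h (X \<omega> - k) t powr (p / 2) \<partial>circle)"
      using P.integrable_fst[OF int] by simp
    show "integrable M (\<lambda>\<omega>. indicator ?A \<omega> * ?B)"
      by (intro integrable_mult_left integrable_const_bound[where B = 1]) (auto split: split_indicator)
    show "(\<integral>t. indicator ?A \<omega> * h (X \<omega> - k) t powr (p / 2) \<partial>circle) \<le> indicator ?A \<omega> * ?B" for \<omega>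
    proof (cases "\<omega> \<in> ?A")
      case True
      then show ?thesis
        using integral_circle_two_point[of c p "X \<omega> - k"] c p by (simp add: h_def)
    qed simp
  qed (use c in auto)
  also have "\<dots> = ?B" using c by (simp add: A)
  finally show ?thesis .
qed

subsection \<open>Sums of independent variables\<close>

lemma measurable_sum_int:
  fixes X :: "'i \<Rightarrow> 'a \<Rightarrow> int"
  assumes "finite I" "\<And>i. i \<in> I \<Longrightarrow> X i \<in> measurable M (count_space UNIV)"
  shows "(\<lambda>\<omega>. \<Sum>i\<in>I. X i \<omega>) \<in> measurable M (count_space UNIV)"
  using assms
proof (induction rule: finite_induct)
  case (insert i I)
  have "(\<lambda>\<omega>. (X i \<omega>, \<Sum>i\<in>I. X i \<omega>)) \<in> measurable M (count_space UNIV \<Otimes>\<^sub>M count_space UNIV)"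
    using insert by (intro measurable_Pair) auto
  then have "(\<lambda>\<omega>. (X i \<omega>, \<Sum>i\<in>I. X i \<omega>)) \<in> measurable M (count_space UNIV)"
    by (simp add: pair_measure_countable)
  from measurable_compose[OF this, of "\<lambda>(a, b). a + b"] show ?case
    using insert by simp
qed simp

lemma (in prob_space) sum_prob_fun_le_1:
  assumes [measurable]: "X \<in> measurable M (count_space UNIV)" and "finite K"
  shows "(\<Sum>k\<in>K. prob_fun M X k) \<le> 1"
proof -
  have "(\<Sum>k\<in>K. prob_fun M X k) = prob (\<Union>k\<in>K. {\<omega> \<in> space M. X \<omega> = k})"
    using assms(2) unfolding prob_fun_def
    by (intro finite_measure_finite_Union[symmetric]) (auto simp: disjoint_family_on_def)
  then show ?thesis by simp
qed

lemma (in prob_space) bdd_above_prob_fun: "bdd_above (range (prob_fun M X))"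
  by (intro bdd_aboveI[where M = 1]) (auto simp: prob_fun_def)

lemma (in prob_space) prob_fun_le_sup_prob: "prob_fun M X k \<le> sup_prob M X"
  unfolding sup_prob_def by (intro cSUP_upper bdd_above_prob_fun) auto

lemma (in prob_space) sup_prob_le:
  "(\<And>k. prob_fun M X k \<le> B) \<Longrightarrow> sup_prob M X \<le> B"
  unfolding sup_prob_def by (intro cSUP_least) auto

text \<open>Otherwise all of the countably many values would be null. Positivity matters because
  \<open>1 / 0 = 0\<close> would spoil the passage to \<open>Delta_inf\<close>.\<close>

lemma (in prob_space) sup_prob_pos:
  assumes [measurable]: "X \<in> measurable M (count_space UNIV)"
  shows "0 < sup_prob M X"
proof (rule ccontr)
  assume "\<not> ?thesis"
  then have "prob_fun M X k = 0" for k
    using prob_fun_le_sup_prob[of X k] measure_nonneg[of M] by (simp add: prob_fun_def order_antisym)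
  then have "AE \<omega> in M. X \<omega> \<noteq> k" for k
    by (intro AE_I[where N = "{\<omega> \<in> space M. X \<omega> = k}"]) (auto simp: prob_fun_def emeasure_eq_measure)
  then have "AE \<omega> in M. \<forall>k. X \<omega> \<noteq> k"
    unfolding AE_all_countable by blast
  then have "AE \<omega> in M. False" by (rule eventually_mono) auto
  then show False by simp
qed

text \<open>A supremum that is not attained is approached by infinitely many distinct masses, and
  three masses close to 1/2 already exceed total mass 1.\<close>

lemma (in prob_space) sup_prob_attained:
  assumes X: "X \<in> measurable M (count_space UNIV)" and half: "1 / 2 \<le> sup_prob M X"
  obtains k where "prob_fun M X k = sup_prob M X"
proof (rule ccontr)
  assume "\<not> thesis"
  then have less: "prob_fun M X k < sup_prob M X" for k
    using that prob_fun_le_sup_prob[of X k] by (auto simp: order.order_iff_strict)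
  have next_value: "\<exists>k. y < prob_fun M X k" if "y < sup_prob M X" for y
    using that less_cSUP_iff[OF UNIV_not_empty bdd_above_prob_fun[of X], of y] by (auto simp: sup_prob_def)
  \<comment> \<open>Any threshold in \<open>[1/3, 1/2)\<close> would serve: below the supremum, and
    with triple at least 1.\<close>
  obtain k0 where k0: "2 / 5 < prob_fun M X k0" using next_value[of "2 / 5"] half by auto
  obtain k1 where k1: "prob_fun M X k0 < prob_fun M X k1" using next_value less by blast
  obtain k2 where k2: "prob_fun M X k1 < prob_fun M X k2" using next_value less by blast
  have "k0 \<noteq> k1" "k1 \<noteq> k2" "k0 \<noteq> k2" using k1 k2 by auto
  then show False
    using sum_prob_fun_le_1[OF X, of "{k0, k1, k2}"] k0 k1 k2 by simp
qed

text \<open>The claim with 1/3 in place of \<open>pi\<^sup>2 / 36\<close>, solved for the supremum.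
  Hoelder appears as weighted AM-GM applied pointwise in \<open>t\<close>, then integrated.\<close>

lemma (in prob_space) sup_prob_sum_le:
  fixes X :: "'i \<Rightarrow> 'a \<Rightarrow> int"
  assumes I: "finite I" and indep: "indep_vars (\<lambda>_. count_space UNIV) X I"
    and half: "\<And>i. i \<in> I \<Longrightarrow> 1 / 2 \<le> sup_prob M (X i)"
  shows "sup_prob M (\<lambda>\<omega>. \<Sum>i\<in>I. X i \<omega>) \<le> 1 / sqrt (1 + (\<Sum>i\<in>I. Delta_inf M (X i)) / 3)"
proof -
  define d where "d = (\<lambda>i. Delta_inf M (X i))"
  define D where "D = (\<Sum>i\<in>I. d i)"
  \<comment> \<open>Sets apart the degenerate variables: they have \<open>d i = 0\<close>, so the
    exponent \<open>D / d i\<close> makes no sense for them.\<close>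
  define J where "J = {i \<in> I. sup_prob M (X i) < 1}"
  define \<phi> where "\<phi> = (\<lambda>i t. cmod (char (distr M borel (\<lambda>\<omega>. real_of_int (X i \<omega>))) t))"
  have X [measurable]: "X i \<in> measurable M (count_space UNIV)" if "i \<in> I" for i
    using indep that by (simp add: indep_vars_def)
  have S: "(\<lambda>\<omega>. \<Sum>i\<in>I. X i \<omega>) \<in> measurable M (count_space UNIV)"
    using I by (intro measurable_sum_int) auto
  have le1: "sup_prob M Y \<le> 1" for Y
    by (intro sup_prob_le) (simp add: prob_fun_def)
  have dpos: "0 < d i" if "i \<in> J" for i
    using that half[of i] by (auto simp: J_def d_def Delta_inf_def power_less_one_iff field_simps)
  have d0: "d i = 0" if "i \<in> I - J" for i
    using that le1[of "X i"] by (auto simp: J_def d_def Delta_inf_def)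
  have J: "finite J" "J \<subseteq> I" using I by (auto simp: J_def)
  have DJ: "D = (\<Sum>i\<in>J. d i)"
    unfolding D_def using I J d0 by (intro sum.mono_neutral_right) auto
  show ?thesis
  proof (cases "J = {}")
    case True
    then have "D = 0" using DJ by simp
    then show ?thesis using le1 by (simp add: D_def d_def)
  next
    case False
    then have D: "0 < D" unfolding DJ using J dpos by (intro sum_pos) auto
    \<comment> \<open>Ensures that the exponent \<open>D / d i\<close> is at least 1, as the power
      mean bound demands.\<close>
    have dD: "d i \<le> D" if "i \<in> J" for i
      unfolding DJ using that J dpos by (intro member_le_sum) (auto intro: less_imp_le)
    let ?B = "1 / sqrt (1 + D / 3)"
    have \<phi>: "0 \<le> \<phi> i t" "\<phi> i t \<le> 1" "\<phi> i \<in> borel_measurable borel" if "i \<in> I" for i t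
    proof -
      interpret D: real_distribution "distr M borel (\<lambda>\<omega>. real_of_int (X i \<omega>))"
        using that by simp
      show "0 \<le> \<phi> i t" "\<phi> i t \<le> 1" "\<phi> i \<in> borel_measurable borel"
        unfolding \<phi>_def by (auto intro: D.cmod_char_le_1)
    qed
    \<comment> \<open>With the exponents \<open>D / d i\<close>, whose reciprocals sum to 1, the bound no longer depends on \<open>i\<close>.\<close>
    have mean: "(\<integral>t. \<phi> i t powr (D / d i) \<partial>circle) \<le> ?B" if "i \<in> J" for i
    proof -
      have i: "i \<in> I" "sup_prob M (X i) < 1" using that by (auto simp: J_def)
      obtain k where k: "prob_fun M (X i) k = sup_prob M (X i)"
        using sup_prob_attained[OF X half] i by blast
      have "(\<integral>t. \<phi> i t powr (D / d i) \<partial>circle) \<le> 1 / sqrt (1 + D / d i * (1 / (sup_prob M (X i))\<^sup>2 - 1) / 3)"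
        unfolding \<phi>_def using i half dD[OF that] dpos[OF that]
        by (intro integral_circle_char_powr_le[OF X k]) auto
      also have "1 / (sup_prob M (X i))\<^sup>2 - 1 = d i"
        by (simp add: d_def Delta_inf_def)
      finally show ?thesis using dpos[OF that] by simp
    qed
    have int: "integrable circle (\<lambda>t. d i / D * \<phi> i t powr (D / d i))" if "i \<in> J" for i
      using \<phi> that J D dpos[OF that]
      by (intro integrable_mult_right integrable_circle_bounded[where B = 1]) (auto intro!: powr_le1)
    have "prob_fun M (\<lambda>\<omega>. \<Sum>i\<in>I. X i \<omega>) k \<le> ?B" for k
    proof -
      have indep': "indep_vars (\<lambda>_. borel) (\<lambda>i \<omega>. real_of_int (X i \<omega>)) I"
        by (intro indep_vars_compose2[OF indep]) auto
      have "prob_fun M (\<lambda>\<omega>. \<Sum>i\<in>I. X i \<omega>) k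
          \<le> (\<integral>t. cmod (char (distr M borel (\<lambda>\<omega>. \<Sum>i\<in>I. real_of_int (X i \<omega>))) t) \<partial>circle)"
        using prob_fun_le_integral_char[OF S, of k] by simp
      also have "\<dots> = (\<integral>t. (\<Prod>i\<in>I. \<phi> i t) \<partial>circle)"
        by (simp add: char_distr_sum[OF indep'] \<phi>_def prod_norm)
      also have "\<dots> \<le> (\<integral>t. (\<Sum>i\<in>J. d i / D * \<phi> i t powr (D / d i)) \<partial>circle)"
      proof (intro integral_mono Bochner_Integration.integrable_sum int)
        show "integrable circle (\<lambda>t. \<Prod>i\<in>I. \<phi> i t)"
          using \<phi> by (intro integrable_circle_bounded[where B = 1])
            (auto simp: abs_prod intro!: prod_le_1)
        fix t
        have "(\<Prod>i\<in>I. \<phi> i t) = (\<Prod>i\<in>J. \<phi> i t) * (\<Prod>i\<in>I - J. \<phi> i t)"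
          using I J by (subst prod.subset_diff[of J I]) (auto simp: mult.commute)
        \<comment> \<open>Degenerate variables contribute factors of at most 1.\<close>
        also have "\<dots> \<le> (\<Prod>i\<in>J. \<phi> i t)"
          using \<phi> J by (intro mult_right_le_one_le prod_nonneg prod_le_1) auto
        also have "\<dots> = (\<Prod>i\<in>J. (\<phi> i t powr (D / d i)) powr (d i / D))"
        proof (intro prod.cong refl)
          show "\<phi> i t = (\<phi> i t powr (D / d i)) powr (d i / D)" if "i \<in> J" for i
            using dpos[OF that] D \<phi>(1)[of i t] J that by (auto simp: powr_powr)
        qed
        also have "\<dots> \<le> (\<Sum>i\<in>J. d i / D * \<phi> i t powr (D / d i))"
          using J D dpos by (intro weighted_arith_geom_mean)
            (auto simp: DJ less_imp_le simp flip: sum_divide_distrib)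
        finally show "(\<Prod>i\<in>I. \<phi> i t) \<le> (\<Sum>i\<in>J. d i / D * \<phi> i t powr (D / d i))" .
      qed
      also have "\<dots> = (\<Sum>i\<in>J. d i / D * (\<integral>t. \<phi> i t powr (D / d i) \<partial>circle))"
        using int by (subst Bochner_Integration.integral_sum) auto
      also have "\<dots> \<le> (\<Sum>i\<in>J. d i / D * ?B)"
        using D by (intro sum_mono mult_left_mono mean) (auto dest: dpos intro!: divide_nonneg_pos less_imp_le)
      also have "\<dots> = ?B"
        unfolding sum_distrib_right[symmetric] sum_divide_distrib[symmetric] DJ[symmetric] using D by simp
      finally show ?thesis .
    qed
    then show ?thesis unfolding D_def d_def by (rule sup_prob_le)
  qed
qed

theorem theorem4p15:
  fixes M :: "'a measure" and X :: "nat \<Rightarrow> 'a \<Rightarrow> int" and c :: "nat \<Rightarrow> real" and n :: nat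
  assumes "prob_space M"
    and "n \<ge> 1"
    and "prob_space.indep_vars M (\<lambda>_. count_space (UNIV :: int set)) X {1..n}"
    and "\<And>i. i \<in> {1..n} \<Longrightarrow> sup_prob M (X i) = c i"
    and "\<And>i. i \<in> {1..n} \<Longrightarrow> c i \<ge> 1 / 2"
  shows "Delta_inf M (\<lambda>\<omega>. \<Sum>i = 1..n. X i \<omega>)
           \<ge> pi\<^sup>2 / 36 * (\<Sum>j = 1..n. Delta_inf M (X j))"
proof -
  interpret prob_space M by fact
  let ?S = "\<lambda>\<omega>. \<Sum>i = 1..n. X i \<omega>"
  define D where "D = (\<Sum>j = 1..n. Delta_inf M (X j))"
  define s where "s = sup_prob M ?S"
  have X [measurable]: "X i \<in> measurable M (count_space UNIV)" if "i \<in> {1..n}" for i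
    using assms(3) that by (simp add: indep_vars_def)
  have D: "0 \<le> D"
    unfolding D_def
  proof (intro sum_nonneg)
    fix i assume "i \<in> {1..n}"
    then have "1 / 2 \<le> sup_prob M (X i)" using assms(4,5) by simp
    moreover have "sup_prob M (X i) \<le> 1" by (intro sup_prob_le) (simp add: prob_fun_def)
    ultimately show "0 \<le> Delta_inf M (X i)"
      by (simp add: Delta_inf_def power_le_one)
  qed
  have s: "0 < s" unfolding s_def by (intro sup_prob_pos measurable_sum_int) auto
  have "s \<le> 1 / sqrt (1 + D / 3)"
    unfolding s_def D_def using assms(3-5) by (intro sup_prob_sum_le) auto
  then have "s\<^sup>2 \<le> (1 / sqrt (1 + D / 3))\<^sup>2"
    using s by (intro power_mono) auto
  also have "\<dots> = 1 / (1 + D / 3)"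
    using D by (simp add: power_divide)
  finally have "1 + D / 3 \<le> 1 / s\<^sup>2"
    using s D by (simp add: field_simps)
  moreover have "pi\<^sup>2 / 36 * D \<le> 1 / 3 * D"
  proof (intro mult_right_mono D)
    \<comment> \<open>Needed is \<open>pi\<^sup>2 \<le> 12\<close>; the square of 17/5 is
      11.56.\<close>
    have "pi \<le> 17 / 5" using pi_approx by simp
    then have "pi\<^sup>2 \<le> (17 / 5)\<^sup>2" by (intro power_mono) auto
    then show "pi\<^sup>2 / 36 \<le> 1 / 3" by (simp add: power2_eq_square)
  qed
  ultimately show ?thesis by (simp add: Delta_inf_def s_def D_def)
qed

end
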